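(* Let $f_1:\mathbb{R}^{mT_f}\to\mathbb{R}$, let $f_2,h:\mathbb{R}^{pT_f}\to\mathbb{R}$, let $\mathcal{U}\subseteq\mathbb{R}^{mT_f}$, $\beta\in(0,1)$, $\varepsilon>0$, $r\in[1,\infty]$, and let past data $u_p\in\mathbb{R}^{mT_p}$, $y_p\in\mathbb{R}^{pT_p}$ be given. Let $\hat K$, $\hat\xi_f^{(i)}$ ($i=1,\dots,N$), $m_f$ (a function of $u_f$), $\hat{\mathbb{P}}_{y_f\mid m_f}$ and $\mathcal{B}_\varepsilon(\hat{\mathbb{P}}_{y_f\mid m_f})$ be as defined in the context. Assume that $f_2$ and $h$ are convex and Lipschitz continuous with constants $L_{\mathrm{obj}}>0$ and $L_{\mathrm{con}}>0$, respectively, with respect to the norm $\|\cdot\|_r$. Then the optimal value of the distributionally robust problem $$\begin{aligned}\min_{u_f}\;& f_1(u_f)+\sup_{Q\in\mathcal{B}_\varepsilon(\hat{\mathbb{P}}_{y_f\mid m_f})}\mathbb{E}_Q[f_2(y_f)]\\ \text{s.t. }& u_f\in\mathcal{U},\\ &\sup_{Q\in\mathcal{B}_\varepsilon(\hat{\mathbb{P}}_{y_f\mid m_f})}\mathrm{CVaR}_Q^{1-\beta}(h(y_f))\le 0\end{aligned}$$ is upper bounded by the optimal value of $$\begin{aligned}\min_{u_f,\,\tau,\,s_1,\dots,s_N}\;& f_1(u_f)+\frac1N\sum_{i=1}^N f_2\big(\hat K m_f+\hat\xi_f^{(i)}\big)+L_{\mathrm{obj}}\,\varepsilon\\ \text{s.t.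 }& u_f\in\mathcal{U},\\ &-\tau\beta+L_{\mathrm{con}}\,\varepsilon+\frac1N\sum_{i=1}^N s_i\le 0,\\ &\tau+h\big(\hat K m_f+\hat\xi_f^{(i)}\big)\le s_i,\quad i=1,\dots,N,\\ & s_i\ge 0,\quad i=1,\dots,N,\end{aligned}$$ where $\tau,s_i\in\mathbb{R}$. Furthermore, any feasible solution $u_f$ of the second problem (i.e. any $u_f$ for which there are $\tau,s_1,\dots,s_N$ making $(u_f,\tau,s_1,\dots,s_N)$ feasible) satisfies $$\mathrm{CVaR}_Q^{1-\beta}(h(y_f))\le 0\qquad\text{for all } Q\in\mathcal{B}_\varepsilon(\hat{\mathbb{P}}_{y_f\mid m_f}).$$
   Context: Data and Hankel matrices. An offline input-output trajectory $\{u_k^d,y_k^d\}_{k=1}^T$ with $u_k^d\in\mathbb{R}^m$, $y_k^d\in\mathbb{R}^p$ is given. Let $T_p,T_f\ge1$, $L=T_p+T_f$, $N=T-L+1\ge 1$. For a sequence $z_1,\dots,z_T$ write $z_{[k,j]}=[z_k^\top\cdots z_j^\top]^\top$, and let $H_L(z)=[z_{[1,L]}\;\cdots\;z_{[T-L+1,T]}]$ be the Hankel matrix of depth $L$. Partition $H_L(u^d)=\begin{bmatrix} U_p \\ U_f \end{bmatrix}$ and $H_L(y^d)=\begin{bmatrix} Y_p \\ Y_f \end{bmatrix}$, where the blocks $U_p,Y_p$ consist of the first $T_p$ block rows and $U_f,Y_f$ of the last $T_f$ block rows. Predictor and residuals. Let $M=\begin{bmatrix} U_p \\ Y_p \\ U_f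 \end{bmatrix}$, let $M^\dagger$ be its Moore-Penrose pseudoinverse, $\hat K=Y_fM^\dagger$ (a least-squares solution of $\min_{\tilde K}\|Y_f-\tilde KM\|_F^2$), and $\hat\xi_f^{(i)}=(Y_f-\hat KM)e_i$, $i=1,\dots,N$, with $e_i$ the $i$-th standard basis vector of $\mathbb{R}^N$. Empirical distribution. For fixed $u_p,y_p$ and decision $u_f\in\mathbb{R}^{mT_f}$ put $m_f=[u_p^\top\; y_p^\top\; u_f^\top]^\top$ and $\hat{\mathbb{P}}_{y_f\mid m_f}=\frac1N\sum_{i=1}^N\delta_{\hat Km_f+\hat\xi_f^{(i)}}$. Ambiguity set. $\mathcal{Y}\subseteq\mathbb{R}^{pT_f}$ is the support set of the (unknown) true distribution of the future output $y_f$ given $m_f$; $\mathcal{M}(\mathcal{Y})$ is the set of probability measures $Q$ supported on $\mathcal{Y}$ with $\mathbb{E}_Q[\|y\|_r]<\infty$. The $r$-Wasserstein distance is $d_{W_r}(Q_1,Q_2)=\big(\inf_\Pi\int\|y_1-y_2\|_r^r\,\Pi(dy_1,dy_2)\big)^{1/r}$, where $\Pi$ ranges over joint measures with marginals $Q_1$ and $Q_2$ and $\|\cdot\|_r$ is the $\ell_r$-norm (for $r=\infty$: the usual $\infty$-Wasserstein distance, $\inf_\Pi$ of the $\Pi$-essential supremum of $\|y_1-y_2\|_\infty$). The ambiguity set is $\mathcal{B}_\varepsilon(\hat{\mathbb{P}}_{y_f\mid m_f})=\{Q\in\mathcal{M}(\mathcal{Y}): d_{W_r}(Q,\hat{\mathbb{P}}_{y_f\mid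 m_f})\le\varepsilon\}$. CVaR. For a random vector $\omega\sim Q$ and real-valued $\phi$, $\mathrm{CVaR}_Q^{1-\beta}(\phi(\omega))=\inf_{t\in\mathbb{R}}\{\frac1\beta\mathbb{E}_Q[(\phi(\omega)-t)_+]+t\}$, with $(\cdot)_+=\max\{\cdot,0\}$. In $\mathbb{E}_Q[f_2(y_f)]$ and $\mathrm{CVaR}_Q^{1-\beta}(h(y_f))$, $y_f$ denotes a random vector with distribution $Q$. The minimum of an infeasible problem is $+\infty$. *)

theory Defs
  imports "HOL-Probability.Probability"
begin

section \<open>Stacked vectors and Hankel matrices\<close>

text \<open>
  A stacked sequence of \<^term>\<open>CARD('t)\<close> vectors of \<open>real ^ 'c\<close> is an element of \<open>real ^ ('t \<times> 'c)\<close>: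
  the first index is the time step (block row), the second one the component. The order on a
  finite time index type only serves to number its elements \<open>0, 1, \<dots>\<close>.
\<close>

definition idx :: "'t::{finite,linorder} \<Rightarrow> nat"
  where "idx t = card {s. s < t}"

lemma idx_less_CARD: "idx (t :: 't::{finite,linorder}) < CARD('t)"
  unfolding idx_def by (rule psubset_card_mono) auto

lemma strict_mono_idx: "strict_mono (idx :: 't::{finite,linorder} \<Rightarrow> nat)"
  unfolding idx_def strict_mono_def
  by (intro allI impI psubset_card_mono) (auto dest: less_trans)

lemma bij_betw_idx: "bij_betw (idx :: 't::{finite,linorder} \<Rightarrow> nat) UNIV {..<CARD('t)}"
proof -
  have inj: "inj (idx :: 't \<Rightarrow> nat)"
    by (rule strict_mono_imp_inj_on) (rule strict_mono_idx)
  have "range (idx :: 't \<Rightarrow> nat) = {..<CARD('t)}"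
    by (rule card_subset_eq) (use idx_less_CARD inj in \<open>auto simp: card_image\<close>)
  with inj show ?thesis by (simp add: bij_betw_def)
qed

text \<open>Block rows of a Hankel matrix of depth \<open>L = T\<^sub>p + T\<^sub>f\<close>: the past steps, then the future ones.\<close>

fun block_idx :: "'tp::{finite,linorder} + 'tf::{finite,linorder} \<Rightarrow> nat" where
  "block_idx (Inl t) = idx t"
| "block_idx (Inr t) = CARD('tp) + idx t"

text \<open>Data sequences are indexed from 1, so the first column is \<open>z\<^sub>1, \<dots>, z\<^sub>L\<close>.\<close>

definition hankel :: "(nat \<Rightarrow> real ^ 'c::finite) \<Rightarrow>
    real ^ 'n::{finite,linorder} ^ (('tp::{finite,linorder} + 'tf::{finite,linorder}) \<times> 'c)"
  where "hankel z = (\<chi> l j. z (1 + idx j + block_idx (fst l)) $ snd l)"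

definition past_rows :: "real ^ 'n ^ (('tp::finite + 'tf::finite) \<times> 'c::finite) \<Rightarrow> real ^ 'n ^ ('tp \<times> 'c)"
  where "past_rows H = (\<chi> l. H $ (Inl (fst l), snd l))"

definition future_rows :: "real ^ 'n ^ (('tp::finite + 'tf::finite) \<times> 'c::finite) \<Rightarrow> real ^ 'n ^ ('tf \<times> 'c)"
  where "future_rows H = (\<chi> l. H $ (Inr (fst l), snd l))"

text \<open>Vertical stacking, both of vectors (\<open>'a = real\<close>) and of matrices (\<open>'a = real ^ 'n\<close>).\<close>

definition stack3 :: "'a ^ 'i::finite \<Rightarrow> 'a ^ 'j::finite \<Rightarrow> 'a ^ 'k::finite \<Rightarrow> 'a ^ ('i + 'j + 'k)"
  where "stack3 a b c = (\<chi> l. case l of Inl i \<Rightarrow> a $ i | Inr (Inl j) \<Rightarrow> b $ j | Inr (Inr k) \<Rightarrow> c $ k)"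


section \<open>Moore-Penrose pseudoinverse\<close>

definition is_pinv :: "real ^ 'n ^ 'm \<Rightarrow> real ^ 'm ^ 'n \<Rightarrow> bool" where
  "is_pinv A X \<longleftrightarrow> A ** X ** A = A \<and> X ** A ** X = X \<and>
     transpose (A ** X) = A ** X \<and> transpose (X ** A) = X ** A"

definition pinv :: "real ^ 'n ^ 'm \<Rightarrow> real ^ 'm ^ 'n"
  where "pinv A = (THE X. is_pinv A X)"

lemma is_pinv_unique:
  assumes X: "is_pinv A X" and Y: "is_pinv A Y"
  shows "X = Y"
proof -
  note x = X[unfolded is_pinv_def] and y = Y[unfolded is_pinv_def]
  have "A ** X = (A ** Y) ** (A ** X)" using y by (simp add: matrix_mul_assoc)
  also have "\<dots> = transpose (A ** Y) ** transpose (A ** X)" using x y by simp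
  also have "\<dots> = transpose (A ** X ** A ** Y)"
    by (simp add: matrix_transpose_mul matrix_mul_assoc)
  also have "\<dots> = A ** Y" using x y by simp
  finally have 1: "A ** X = A ** Y" .
  have "X ** A = (X ** A) ** (Y ** A)" using y by (metis matrix_mul_assoc)
  also have "\<dots> = transpose (X ** A) ** transpose (Y ** A)" using x y by simp
  also have "\<dots> = transpose (Y ** (A ** X ** A))"
    by (simp add: matrix_transpose_mul matrix_mul_assoc)
  also have "\<dots> = Y ** A" using x y by simp
  finally have 2: "X ** A = Y ** A" .
  have "X = X ** A ** X" using x by simp
  also have "\<dots> = Y ** (A ** X)" by (simp add: 2 matrix_mul_assoc)
  also have "\<dots> = Y" using y by (simp add: 1 matrix_mul_assoc)
  finally show ?thesis .
qed

lemma transpose_mul_self_cancel: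
  fixes A :: "real ^ 'n ^ 'm" and B C :: "real ^ 'k ^ 'n"
  assumes "transpose A ** (A ** B) = transpose A ** (A ** C)"
  shows "A ** B = A ** C"
proof -
  have "A *v (B *v x) = A *v (C *v x)" for x
  proof -
    let ?v = "A *v (B *v x) - A *v (C *v x)"
    have 0: "transpose A *v ?v = 0"
      using arg_cong[OF assms, of "\<lambda>M. M *v x"]
      by (simp add: matrix_vector_mul_assoc[symmetric] matrix_vector_mult_diff_distrib)
    have "?v \<bullet> ?v = (A *v (B *v x - C *v x)) \<bullet> ?v"
      by (simp add: matrix_vector_mult_diff_distrib)
    also have "\<dots> = (B *v x - C *v x) \<bullet> (transpose A *v ?v)"
      by (metis dot_lmul_matrix inner_commute transpose_matrix_vector transpose_transpose)
    also have "\<dots> = 0" unfolding 0 by simp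
    finally show ?thesis by simp
  qed
  then show ?thesis
    by (simp add: matrix_eq matrix_vector_mul_assoc[symmetric])
qed

lemma generalized_inverse_exists:
  fixes A :: "real ^ 'n ^ 'm"
  shows "\<exists>G. A ** G ** A = A"
proof -
  obtain g where g: "linear g" "\<forall>v\<in>range ((*v) A). A *v (g v) = v"
    using linear_exists_right_inverse_on[OF matrix_vector_mul_linear subspace_UNIV, of A] by blast
  have "A ** matrix g ** A = A"
    using g by (simp add: matrix_eq matrix_vector_mul_assoc[symmetric] matrix_works)
  then show ?thesis by blast
qed

lemma is_pinv_exists:
  fixes A :: "real ^ 'n ^ 'm"
  shows "\<exists>X. is_pinv A X"
proof -
  let ?T = "transpose A"
  note assoc = matrix_mul_assoc[symmetric]
  obtain G where G: "(?T ** A ** ?T) ** G ** (?T ** A ** ?T) = ?T ** A ** ?T"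
    using generalized_inverse_exists by blast
  define X where "X = ?T ** G ** ?T"
  have "?T ** (A ** (?T ** (G ** (?T ** (A ** ?T))))) = ?T ** (A ** ?T)"
    using G by (simp add: assoc)
  then have "A ** (?T ** (G ** (?T ** (A ** ?T)))) = A ** ?T"
    by (rule transpose_mul_self_cancel)
  then have a: "?T ** (G ** (?T ** (A ** ?T))) = ?T"
    using transpose_mul_self_cancel[of ?T "G ** (?T ** (A ** ?T))" "mat 1"] by simp
  have XAT: "X ** A ** ?T = ?T"
    using a by (simp add: X_def assoc)
  have "transpose (X ** A ** ?T) = transpose ?T" by (simp add: XAT)
  then have AXA': "A ** (?T ** transpose X) = A"
    by (simp add: matrix_transpose_mul)
  have "X ** A ** (?T ** transpose X) = ?T ** transpose X"
    by (simp add: matrix_mul_assoc XAT)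
  then have XA: "transpose (X ** A) = X ** A"
    by (simp add: matrix_transpose_mul assoc AXA')
  have AXA: "A ** X ** A = A"
    using AXA' XA by (simp add: matrix_transpose_mul assoc)
  have XAX: "X ** A ** X = X"
  proof -
    have "X ** A ** X = (X ** A ** ?T) ** G ** ?T"
      by (simp add: X_def assoc)
    then show ?thesis by (simp add: XAT) (simp add: X_def)
  qed
  have TAX: "?T ** A ** X = ?T"
  proof -
    have "(?T ** A ** ?T) ** G ** ?T ** A ** ?T = ?T ** A ** ?T"
      using G by (simp add: assoc)
    then have "transpose ((?T ** A ** ?T) ** G ** ?T ** A ** ?T) = transpose (?T ** A ** ?T)"
      by simp
    then have "A ** (?T ** (A ** (transpose G ** (A ** (?T ** A))))) = A ** (?T ** A)"
      by (simp add: matrix_transpose_mul assoc)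
    then have "?T ** (A ** (transpose G ** (A ** (?T ** A)))) = ?T ** A"
      using transpose_mul_self_cancel[of ?T "A ** (transpose G ** (A ** (?T ** A)))" A] by simp
    then have "A ** (transpose G ** (A ** (?T ** A))) = A"
      using transpose_mul_self_cancel[of A "transpose G ** (A ** (?T ** A))" "mat 1"] by simp
    then have "transpose (A ** (transpose G ** (A ** (?T ** A)))) = ?T" by simp
    then show ?thesis by (simp add: X_def matrix_transpose_mul assoc)
  qed
  have "transpose X ** (?T ** A ** X) = transpose (A ** X)"
    by (simp add: TAX matrix_transpose_mul)
  moreover have "transpose (transpose X ** (?T ** A ** X)) = transpose X ** (?T ** A ** X)"
    by (simp add: matrix_transpose_mul assoc)
  ultimately have AX: "transpose (A ** X) = A ** X" by simp
  from AXA XAX AX XA show ?thesis unfolding is_pinv_def by blast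
qed

lemma is_pinv_pinv: "is_pinv A (pinv A)"
  unfolding pinv_def by (rule theI') (use is_pinv_exists is_pinv_unique in blast)


section \<open>Norms, measures and the ambiguity set\<close>

definition lr_norm :: "ereal \<Rightarrow> real ^ 'k \<Rightarrow> real" where
  "lr_norm r x = (if r = \<infinity> then infnorm x
     else (\<Sum>i\<in>UNIV. \<bar>x $ i\<bar> powr real_of_ereal r) powr (1 / real_of_ereal r))"

definition lipschitz_lr :: "ereal \<Rightarrow> real \<Rightarrow> (real ^ 'k \<Rightarrow> real) \<Rightarrow> bool" where
  "lipschitz_lr r L f \<longleftrightarrow> (\<forall>x y. \<bar>f x - f y\<bar> \<le> L * lr_norm r (x - y))"

definition measure_support :: "'a::topological_space measure \<Rightarrow> 'a set" where
  "measure_support P = {y. \<forall>V. open V \<and> y \<in> V \<longrightarrow> emeasure P V > 0}"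

definition empirical :: "('n::finite \<Rightarrow> 'a::topological_space) \<Rightarrow> 'a measure" where
  "empirical a = distr (uniform_count_measure UNIV) borel a"

lemma emeasure_empirical:
  fixes a :: "'n::finite \<Rightarrow> 'a::topological_space"
  assumes "A \<in> sets borel"
  shows "emeasure (empirical a) A = (\<Sum>i\<in>UNIV. emeasure (return borel (a i)) A) / of_nat CARD('n)"
proof -
  have "a \<in> uniform_count_measure UNIV \<rightarrow>\<^sub>M borel"
    by (simp add: measurable_def sets_uniform_count_measure space_uniform_count_measure)
  then have "emeasure (empirical a) A = of_nat (card (a -` A)) / of_nat CARD('n)"
    using assms
    by (simp add: empirical_def emeasure_distr space_uniform_count_measure
        emeasure_uniform_count_measure divide_ennreal ennreal_of_nat_eq_real_of_nat)
  also have "of_nat (card (a -` A)) = (\<Sum>i\<in>UNIV. emeasure (return borel (a i)) A)"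
    using assms by (simp add: indicator_def of_bool_def sum.If_cases vimage_def)
  finally show ?thesis .
qed

text \<open>The probability measures supported on \<open>Y\<close> with finite first moment.\<close>

definition prob_on :: "ereal \<Rightarrow> (real ^ 'k) set \<Rightarrow> (real ^ 'k) measure set" where
  "prob_on r Y = {Q. sets Q = sets borel \<and> prob_space Q \<and> (AE y in Q. y \<in> Y) \<and>
     (\<integral>\<^sup>+ y. ennreal (lr_norm r y) \<partial>Q) < \<infinity>}"

definition couplings :: "'a::topological_space measure \<Rightarrow> 'a measure \<Rightarrow> ('a \<times> 'a) measure set" where
  "couplings Q1 Q2 = {\<gamma>. sets \<gamma> = sets (borel \<Otimes>\<^sub>M borel) \<and> prob_space \<gamma> \<and>
     distr \<gamma> borel fst = Q1 \<and> distr \<gamma> borel snd = Q2}"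

definition ennreal_powr :: "ennreal \<Rightarrow> real \<Rightarrow> ennreal" where
  "ennreal_powr x a = (if x = \<infinity> then \<infinity> else ennreal (enn2real x powr a))"

definition wasserstein :: "ereal \<Rightarrow> (real ^ 'k) measure \<Rightarrow> (real ^ 'k) measure \<Rightarrow> ennreal" where
  "wasserstein r Q1 Q2 =
     (if r = \<infinity> then
        (INF \<gamma>\<in>couplings Q1 Q2. esssup \<gamma> (\<lambda>(y1, y2). ennreal (lr_norm r (y1 - y2))))
      else
        ennreal_powr
          (INF \<gamma>\<in>couplings Q1 Q2.
             \<integral>\<^sup>+ (y1, y2). ennreal (lr_norm r (y1 - y2) powr real_of_ereal r) \<partial>\<gamma>)
          (1 / real_of_ereal r))"

definition ambiguity_set ::
    "ereal \<Rightarrow> (real ^ 'k) set \<Rightarrow> real \<Rightarrow> (real ^ 'k) measure \<Rightarrow> (real ^ 'k) measure set" where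
  "ambiguity_set r Y \<epsilon> P = {Q \<in> prob_on r Y. wasserstein r Q P \<le> ennreal \<epsilon>}"

text \<open>
  \<open>cvar Q \<beta> \<phi>\<close> is the conditional value-at-risk of \<open>\<phi>\<close> under \<open>Q\<close> at level \<open>1 - \<beta>\<close>. The integrand is
  nonnegative, so the extended-valued formula is meaningful for all measurable \<open>\<phi>\<close>.
\<close>

definition cvar :: "'a measure \<Rightarrow> real \<Rightarrow> ('a \<Rightarrow> real) \<Rightarrow> ereal" where
  "cvar Q \<beta> \<phi> = (INF t::real.
     ereal (1 / \<beta>) * enn2ereal (\<integral>\<^sup>+ \<omega>. ennreal (max (\<phi> \<omega> - t) 0) \<partial>Q) + ereal t)"


section \<open>The two optimization problems\<close>

text \<open>
  Optimal values are infima in \<^typ>\<open>ereal\<close>; the infimum over an empty feasible set is \<open>\<infinity>\<close>.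
  \<open>B u\<^sub>f\<close> is the ambiguity set and \<open>a u\<^sub>f i\<close> the \<open>i\<close>-th atom of the empirical distribution for the
  decision \<open>u\<^sub>f\<close>. A Lipschitz \<open>f2\<close> is integrable with respect to every measure with finite first
  moment, so the Bochner integral in the objective is a genuine expectation.
\<close>

definition dro_value ::
    "('u \<Rightarrow> real) \<Rightarrow> ('y \<Rightarrow> real) \<Rightarrow> ('y \<Rightarrow> real) \<Rightarrow> 'u set \<Rightarrow> real \<Rightarrow> ('u \<Rightarrow> 'y measure set) \<Rightarrow> ereal" where
  "dro_value f1 f2 h U \<beta> B =
     (INF uf\<in>{uf \<in> U. (SUP Q\<in>B uf. cvar Q \<beta> h) \<le> 0}.
        ereal (f1 uf) + (SUP Q\<in>B uf. ereal (\<integral>y. f2 y \<partial>Q)))"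

definition reform_feasible ::
    "('y \<Rightarrow> real) \<Rightarrow> 'u set \<Rightarrow> real \<Rightarrow> real \<Rightarrow> real \<Rightarrow> ('u \<Rightarrow> 'n::finite \<Rightarrow> 'y) \<Rightarrow>
      'u \<Rightarrow> real \<Rightarrow> ('n \<Rightarrow> real) \<Rightarrow> bool" where
  "reform_feasible h U \<beta> Lcon \<epsilon> a uf \<tau> s \<longleftrightarrow>
     uf \<in> U \<and>
     - \<tau> * \<beta> + Lcon * \<epsilon> + 1 / real CARD('n) * (\<Sum>i\<in>UNIV. s i) \<le> 0 \<and>
     (\<forall>i. \<tau> + h (a uf i) \<le> s i) \<and>
     (\<forall>i. s i \<ge> 0)"

definition reform_value ::
    "('u \<Rightarrow> real) \<Rightarrow> ('y \<Rightarrow> real) \<Rightarrow> ('y \<Rightarrow> real) \<Rightarrow> 'u set \<Rightarrow> real \<Rightarrow> real \<Rightarrow> real \<Rightarrow> real \<Rightarrow>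
      ('u \<Rightarrow> 'n::finite \<Rightarrow> 'y) \<Rightarrow> ereal" where
  "reform_value f1 f2 h U \<beta> Lobj Lcon \<epsilon> a =
     (INF (uf, \<tau>, s)\<in>{(uf, \<tau>, s). reform_feasible h U \<beta> Lcon \<epsilon> a uf \<tau> s}.
        ereal (f1 uf + 1 / real CARD('n) * (\<Sum>i\<in>UNIV. f2 (a uf i)) + Lobj * \<epsilon>))"

end

theory Submission
  imports Defs
begin

text \<open>
  A distribution \<open>Q\<close> in the ambiguity set has couplings with the empirical distribution \<open>P\<close> whose
  mean transport cost is at most any given number above \<open>\<epsilon>\<close>. Integrating \<open>g y1 \<le> g y2 + L * \<parallel>y1 - y2\<parallel>\<close> against them
  gives the easy half of Kantorovich-Rubinstein duality, \<open>E\<^sub>Q g \<le> E\<^sub>P g + L * \<epsilon>\<close>. It is applied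
  to \<open>f2\<close> and, bounding the infimum defining CVaR by its value at \<open>t = -\<tau>\<close>, to \<open>max (h + \<tau>) 0\<close>.
\<close>

section \<open>Sign and measurability of the norm\<close>

lemma lr_norm_nonneg: "0 \<le> lr_norm r x"
  by (simp add: lr_norm_def infnorm_pos_le)

lemma borel_measurable_lr_norm [measurable]: "(lr_norm r :: real ^ 'k \<Rightarrow> real) \<in> borel_measurable borel"
proof (cases "r = \<infinity>")
  case True
  then have "lr_norm r = (infnorm :: real ^ 'k \<Rightarrow> real)" by (auto simp: lr_norm_def)
  moreover have "continuous_on UNIV (infnorm :: real ^ 'k \<Rightarrow> real)"
    by (rule continuous_on_infnorm[OF continuous_on_id])
  ultimately show ?thesis
    by (simp add: borel_measurable_continuous_onI)
next
  case False
  then have "lr_norm r = (\<lambda>x :: real ^ 'k. (\<Sum>i\<in>UNIV. \<bar>x $ i\<bar> powr real_of_ereal r) powr (1 / real_of_ereal r))"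
    by (auto simp: lr_norm_def)
  then show ?thesis
    by (simp add: borel_measurable_continuous_onI) measurable
qed

section \<open>Bounding first moments by \<open>p\<close>-th moments\<close>

text \<open>Bernoulli's inequality rearranged: \<open>u powr p\<close> lies above its tangent
  \<open>1 + p * (u - 1)\<close> at \<open>u = 1\<close>.\<close>

lemma le_powr_tangent:
  fixes u p :: real
  assumes "0 \<le> u" "1 \<le> p"
  shows "u \<le> 1 - 1 / p + u powr p / p"
proof (cases "u = 0")
  case True
  then show ?thesis using assms by (simp add: divide_simps)
next
  case False
  \<comment> \<open>Weighted AM-GM at the points \<open>u powr p\<close> and \<open>1\<close>, with
    weights \<open>1 / p\<close> and \<open>1 - 1 / p\<close>.\<close>
  then show ?thesis
    using Youngs_inequality_0[of "1 / p" "1 - 1 / p" "u powr p" 1] assms by (simp add: powr_powr)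
qed

text \<open>
  Integrating the tangent inequality at the scale \<open>\<eta>\<close> replaces Jensen's inequality.
\<close>
lemma nn_integral_le_if_powr:
  fixes f :: "'a \<Rightarrow> real"
  assumes "prob_space M" and [measurable]: "f \<in> borel_measurable M"
    and f: "\<And>x. 0 \<le> f x" and "1 \<le> p" "0 < \<eta>"
    and I: "(\<integral>\<^sup>+x. ennreal (f x powr p) \<partial>M) \<le> ennreal (\<eta> powr p)"
  shows "(\<integral>\<^sup>+x. ennreal (f x) \<partial>M) \<le> ennreal \<eta>"
proof -
  interpret prob_space M by fact
  \<comment> \<open>\<open>A\<close> and \<open>C\<close> come from the tangent inequality at
    \<open>f x / \<eta>\<close>, multiplied by \<open>\<eta>\<close>. The tangent touches where
    \<open>f x = \<eta>\<close>, so \<open>A + C * \<eta> powr p\<close> returns exactly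
    \<open>\<eta>\<close>.\<close>
  define A where "A = \<eta> * (1 - 1 / p)"
  define C where "C = \<eta> / (p * \<eta> powr p)"
  have A: "0 \<le> A" and C: "0 \<le> C" using assms by (auto simp: A_def C_def divide_simps)
  have AC: "A + C * \<eta> powr p = \<eta>" using assms by (simp add: A_def C_def field_simps)
  have *: "f x \<le> A + C * f x powr p" for x
  proof -
    have "f x / \<eta> \<le> 1 - 1 / p + (f x / \<eta>) powr p / p"
      using assms by (intro le_powr_tangent) auto
    then have "\<eta> * (f x / \<eta>) \<le> \<eta> * (1 - 1 / p + (f x / \<eta>) powr p / p)"
      using assms by (intro mult_left_mono) auto
    then show ?thesis using assms by (simp add: A_def C_def powr_divide algebra_simps)
  qed
  have "(\<integral>\<^sup>+x. ennreal (f x) \<partial>M) \<le> (\<integral>\<^sup>+x. ennreal A + ennreal C * ennreal (f x powr p) \<partial>M)"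
    using * A C by (intro nn_integral_mono) (simp flip: ennreal_mult ennreal_plus add: ennreal_leI)
  also have "\<dots> = ennreal A + ennreal C * (\<integral>\<^sup>+x. ennreal (f x powr p) \<partial>M)"
    by (simp add: nn_integral_add nn_integral_cmult emeasure_space_1)
  also have "\<dots> \<le> ennreal A + ennreal C * ennreal (\<eta> powr p)"
    using I by (intro add_left_mono mult_left_mono) auto
  also have "\<dots> = ennreal \<eta>"
    using A C AC by (simp flip: ennreal_mult ennreal_plus)
  finally show ?thesis .
qed

section \<open>Couplings and their transport cost\<close>

lemma measurable_transport_cost [measurable]:
  "(\<lambda>z :: (real ^ 'k) \<times> (real ^ 'k). lr_norm r (fst z - snd z)) \<in> borel_measurable (borel \<Otimes>\<^sub>M borel)"
  by measurable

text \<open>An infimum yields a coupling only with some slack, hence \<open>\<eta>\<close> strictly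
  above \<open>\<epsilon>\<close>. On a probability space the mean cost is dominated by the
  essential supremum and, for \<open>p\<close> at least 1, by the \<open>p\<close>-th root of the
  \<open>p\<close>-th moment.\<close>

lemma coupling_mean_cost_le:
  assumes W: "wasserstein r Q P \<le> ennreal \<epsilon>" and "0 < \<epsilon>" "\<epsilon> < \<eta>" "1 \<le> r"
  obtains \<gamma> where "\<gamma> \<in> couplings Q P"
    "(\<integral>\<^sup>+z. ennreal (lr_norm r (fst z - snd z)) \<partial>\<gamma>) \<le> ennreal \<eta>"
proof (cases "r = \<infinity>")
  case True
  let ?c = "\<lambda>(y1, y2). ennreal (lr_norm r (y1 - y2))"
  have "(INF \<gamma>\<in>couplings Q P. esssup \<gamma> ?c) < ennreal \<eta>"
    using W True assms by (simp add: wasserstein_def ennreal_less_iff order.strict_trans1)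
  then obtain \<gamma> where g: "\<gamma> \<in> couplings Q P" and lt: "esssup \<gamma> ?c < ennreal \<eta>"
    by (auto simp: INF_less_iff)
  interpret prob_space \<gamma> using g by (simp add: couplings_def)
  have [measurable_cong]: "sets \<gamma> = sets (borel \<Otimes>\<^sub>M borel)" using g by (simp add: couplings_def)
  have "AE z in \<gamma>. ?c z \<le> esssup \<gamma> ?c"
    by (rule esssup_AE)
  then have "AE z in \<gamma>. ennreal (lr_norm r (fst z - snd z)) \<le> ennreal \<eta>"
    using lt by (auto elim!: eventually_mono simp: case_prod_beta)
  then have "(\<integral>\<^sup>+z. ennreal (lr_norm r (fst z - snd z)) \<partial>\<gamma>) \<le> (\<integral>\<^sup>+z. ennreal \<eta> \<partial>\<gamma>)"
    by (rule nn_integral_mono_AE)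
  also have "\<dots> = ennreal \<eta>" by (simp add: emeasure_space_1)
  finally show ?thesis using that g by blast
next
  case False
  define p where "p = real_of_ereal r"
  have p: "1 \<le> p" using False \<open>1 \<le> r\<close> unfolding p_def by (cases r) auto
  let ?c = "\<lambda>(y1, y2). ennreal (lr_norm r (y1 - y2) powr p)"
  define I where "I = (INF \<gamma>\<in>couplings Q P. \<integral>\<^sup>+z. ?c z \<partial>\<gamma>)"
  have W': "ennreal_powr I (1 / p) \<le> ennreal \<epsilon>"
    using W False by (simp add: wasserstein_def I_def p_def)
  \<comment> \<open>An infinite \<open>I\<close> would have an infinite root, contradicting the
    finite radius.\<close>
  then have fin: "I \<noteq> \<infinity>" by (auto simp: ennreal_powr_def top_unique)
  with W' \<open>0 < \<epsilon>\<close> have "enn2real I powr (1 / p) \<le> \<epsilon>" by (simp add: ennreal_powr_def)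
  \<comment> \<open>The \<open>p\<close>-th power undoes the root, and the gap between
    \<open>\<epsilon>\<close> and \<open>\<eta>\<close> gives the strict bound needed to pick a
    coupling.\<close>
  then have "(enn2real I powr (1 / p)) powr p \<le> \<epsilon> powr p"
    using p by (intro powr_mono2) auto
  also have "\<dots> < \<eta> powr p" using assms p by (intro powr_less_mono2) auto
  finally have "enn2real I < \<eta> powr p" using p by (simp add: powr_powr)
  then have "I < ennreal (\<eta> powr p)"
    using fin by (cases I) (auto simp: ennreal_less_iff)
  then obtain \<gamma> where g: "\<gamma> \<in> couplings Q P" and lt: "(\<integral>\<^sup>+z. ?c z \<partial>\<gamma>) < ennreal (\<eta> powr p)"
    by (auto simp: I_def INF_less_iff)
  have [measurable_cong]: "sets \<gamma> = sets (borel \<Otimes>\<^sub>M borel)" using g by (simp add: couplings_def)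
  have "(\<integral>\<^sup>+z. ennreal (lr_norm r (fst z - snd z)) \<partial>\<gamma>) \<le> ennreal \<eta>"
  proof (rule nn_integral_le_if_powr)
    show "prob_space \<gamma>" using g by (simp add: couplings_def)
  qed (use lt p assms in \<open>auto simp: lr_norm_nonneg case_prod_beta\<close>)
  then show ?thesis using that g by blast
qed

section \<open>Comparing expectations\<close>

text \<open>The push-forward is taken from the index type, so coinciding atoms count with
  multiplicity and the expectation is a plain average over indices.\<close>

lemma
  fixes a :: "'n::finite \<Rightarrow> 'a::topological_space" and g :: "'a \<Rightarrow> real"
  assumes [measurable]: "g \<in> borel_measurable borel"
  shows integrable_empirical: "integrable (empirical a) g"
    and integral_empirical: "(\<integral>y. g y \<partial>empirical a) = 1 / real CARD('n) * (\<Sum>i\<in>UNIV. g (a i))"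
proof -
  have [measurable]: "a \<in> uniform_count_measure UNIV \<rightarrow>\<^sub>M borel"
    by (simp add: measurable_def sets_uniform_count_measure space_uniform_count_measure)
  show "integrable (empirical a) g"
    unfolding empirical_def
    by (subst integrable_distr_eq) (auto simp: uniform_count_measure_def integrable_point_measure_finite)
  show "(\<integral>y. g y \<partial>empirical a) = 1 / real CARD('n) * (\<Sum>i\<in>UNIV. g (a i))"
    unfolding empirical_def
    by (subst integral_distr) (auto simp: uniform_count_measure_def lebesgue_integral_point_measure_finite sum_distrib_left)
qed

text \<open>Comparison with the point 0 gives the majorant
  \<open>\<bar>g 0\<bar> + L * lr_norm r y\<close>, integrable by the finite first moment in
  \<open>prob_on\<close>. The Bochner integral of \<open>g\<close> is thus a genuine expectation,
  not the default 0.\<close>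

lemma integrable_lipschitz_lr:
  fixes g :: "real ^ 'k \<Rightarrow> real"
  assumes g [measurable]: "g \<in> borel_measurable borel" and lip: "lipschitz_lr r L g" and "0 \<le> L"
    and Q: "Q \<in> prob_on r Y"
  shows "integrable Q g"
proof -
  interpret prob_space Q using Q by (simp add: prob_on_def)
  have [measurable_cong]: "sets Q = sets borel" using Q by (simp add: prob_on_def)
  have "integrable Q (lr_norm r)"
    using Q by (intro integrableI_bounded) (auto simp: prob_on_def lr_norm_nonneg)
  then have "integrable Q (\<lambda>y. \<bar>g 0\<bar> + L * lr_norm r y)" by simp
  then show ?thesis
  proof (rule Bochner_Integration.integrable_bound)
    have "norm (g y) \<le> norm (\<bar>g 0\<bar> + L * lr_norm r y)" for y
      using lip[unfolded lipschitz_lr_def, rule_format, of y 0] by simp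
    then show "AE y in Q. norm (g y) \<le> norm (\<bar>g 0\<bar> + L * lr_norm r y)" by simp
  qed simp
qed

text \<open>Both expectations become integrals over the coupling, where the Lipschitz bound applies
  pointwise.\<close>

lemma integral_le_of_coupling:
  fixes g :: "real ^ 'k \<Rightarrow> real"
  assumes [measurable]: "g \<in> borel_measurable borel" and lip: "lipschitz_lr r L g" and "0 \<le> L"
    and Q: "integrable Q g" and P: "integrable P g" and \<gamma>: "\<gamma> \<in> couplings Q P" and "0 \<le> \<eta>"
    and c: "(\<integral>\<^sup>+z. ennreal (lr_norm r (fst z - snd z)) \<partial>\<gamma>) \<le> ennreal \<eta>"
  shows "(\<integral>y. g y \<partial>Q) \<le> (\<integral>y. g y \<partial>P) + L * \<eta>"
proof -
  have [measurable_cong]: "sets \<gamma> = sets (borel \<Otimes>\<^sub>M borel)"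
    and Q': "Q = distr \<gamma> borel fst" and P': "P = distr \<gamma> borel snd"
    using \<gamma> by (auto simp: couplings_def)
  have [measurable]: "fst \<in> \<gamma> \<rightarrow>\<^sub>M borel" "snd \<in> \<gamma> \<rightarrow>\<^sub>M borel" by measurable
  have i1: "integrable \<gamma> (\<lambda>z. g (fst z))" and i2: "integrable \<gamma> (\<lambda>z. g (snd z))"
    using Q P unfolding Q' P' by (simp_all add: integrable_distr_eq)
  \<comment> \<open>The cost bound is finite, so the cost is integrable and its
    \<open>nn_integral\<close> can be read as a real integral.\<close>
  have i3: "integrable \<gamma> (\<lambda>z. lr_norm r (fst z - snd z))"
    using c by (intro integrableI_bounded) (auto simp: lr_norm_nonneg intro: le_less_trans)
  have cost: "(\<integral>z. lr_norm r (fst z - snd z) \<partial>\<gamma>) \<le> \<eta>"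
    using c \<open>0 \<le> \<eta>\<close> by (simp add: nn_integral_eq_integral[OF i3] lr_norm_nonneg)
  have "(\<integral>y. g y \<partial>Q) = (\<integral>z. g (fst z) \<partial>\<gamma>)" unfolding Q' by (simp add: integral_distr)
  also have "\<dots> \<le> (\<integral>z. g (snd z) + L * lr_norm r (fst z - snd z) \<partial>\<gamma>)"
  proof (rule integral_mono)
    fix z
    show "g (fst z) \<le> g (snd z) + L * lr_norm r (fst z - snd z)"
      using lip[unfolded lipschitz_lr_def, rule_format, of "fst z" "snd z"] by simp
  qed (use i1 i2 i3 in auto)
  also have "\<dots> = (\<integral>y. g y \<partial>P) + L * (\<integral>z. lr_norm r (fst z - snd z) \<partial>\<gamma>)"
    using i2 i3 unfolding P' by (simp add: integral_distr)
  also have "\<dots> \<le> (\<integral>y. g y \<partial>P) + L * \<eta>"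
    using cost \<open>0 \<le> L\<close> by (simp add: mult_left_mono)
  finally show ?thesis .
qed

lemma integral_ambiguity_set_le:
  fixes g :: "real ^ 'k \<Rightarrow> real"
  assumes g: "g \<in> borel_measurable borel" and lip: "lipschitz_lr r L g" and L: "0 < L"
    and Q: "Q \<in> ambiguity_set r Y \<epsilon> P" and P: "integrable P g" and "0 < \<epsilon>" "1 \<le> r"
  shows "(\<integral>y. g y \<partial>Q) \<le> (\<integral>y. g y \<partial>P) + L * \<epsilon>"
proof -
  have Q': "Q \<in> prob_on r Y" and W: "wasserstein r Q P \<le> ennreal \<epsilon>"
    using Q by (auto simp: ambiguity_set_def)
  \<comment> \<open>Dividing by \<open>L\<close> isolates \<open>\<eta>\<close>, so that
    \<open>dense_ge\<close> can let it decrease to \<open>\<epsilon>\<close>.\<close>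
  have "((\<integral>y. g y \<partial>Q) - (\<integral>y. g y \<partial>P)) / L \<le> \<eta>" if "\<epsilon> < \<eta>" for \<eta>
  proof -
    from coupling_mean_cost_le[OF W \<open>0 < \<epsilon>\<close> that \<open>1 \<le> r\<close>]
    obtain \<gamma> where "\<gamma> \<in> couplings Q P" "(\<integral>\<^sup>+z. ennreal (lr_norm r (fst z - snd z)) \<partial>\<gamma>) \<le> ennreal \<eta>"
      by blast
    then have "(\<integral>y. g y \<partial>Q) \<le> (\<integral>y. g y \<partial>P) + L * \<eta>"
      using integrable_lipschitz_lr[OF g lip _ Q'] assms that by (intro integral_le_of_coupling) auto
    then show ?thesis using L by (simp add: field_simps)
  qed
  then have "((\<integral>y. g y \<partial>Q) - (\<integral>y. g y \<partial>P)) / L \<le> \<epsilon>" by (rule dense_ge)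
  then show ?thesis using L by (simp add: field_simps)
qed

section \<open>Measurability of convex functions and the CVaR bound\<close>

lemma borel_measurable_convex:
  fixes g :: "'a::euclidean_space \<Rightarrow> real"
  assumes "convex_on UNIV g"
  shows "g \<in> borel_measurable borel"
  using assms by (intro borel_measurable_continuous_onI convex_on_continuous) auto

lemma cvar_le_0:
  fixes a :: "'n::finite \<Rightarrow> real ^ 'k" and h :: "real ^ 'k \<Rightarrow> real"
  assumes [measurable]: "h \<in> borel_measurable borel" and lip: "lipschitz_lr r L h" and "0 < L"
    and Q: "Q \<in> ambiguity_set r Y \<epsilon> (empirical a)" and "0 < \<epsilon>" "1 \<le> r" "0 < \<beta>"
    and s: "- \<tau> * \<beta> + L * \<epsilon> + 1 / real CARD('n) * (\<Sum>i\<in>UNIV. s i) \<le> 0"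
      "\<And>i. \<tau> + h (a i) \<le> s i" "\<And>i. 0 \<le> s i"
  shows "cvar Q \<beta> h \<le> 0"
proof -
  \<comment> \<open>This is the integrand of \<open>cvar\<close> at \<open>t = - \<tau>\<close>,
    written so that both unfold to the same term.\<close>
  define g where "g y = max (h y - (- \<tau>)) 0" for y
  have g [measurable]: "g \<in> borel_measurable borel" unfolding g_def by measurable
  \<comment> \<open>The positive part is nonexpansive, so \<open>g\<close> inherits the constant
    \<open>L\<close>.\<close>
  have "\<bar>g x - g y\<bar> \<le> \<bar>h x - h y\<bar>" for x y by (auto simp: g_def)
  with lip have lipg: "lipschitz_lr r L g" unfolding lipschitz_lr_def by (meson order_trans)
  have "(\<integral>y. g y \<partial>Q) \<le> 1 / real CARD('n) * (\<Sum>i\<in>UNIV. g (a i)) + L * \<epsilon>"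
    using integral_ambiguity_set_le[OF g lipg _ Q integrable_empirical] assms
    by (simp add: integral_empirical)
  \<comment> \<open>The slack \<open>s i\<close> dominates both \<open>\<tau> + h (a i)\<close> and
    0, hence the positive part.\<close>
  also have "(\<Sum>i\<in>UNIV. g (a i)) \<le> (\<Sum>i\<in>UNIV. s i)"
    using s(2,3) by (intro sum_mono) (simp add: g_def add.commute)
  finally have "(\<integral>y. g y \<partial>Q) \<le> 1 / real CARD('n) * (\<Sum>i\<in>UNIV. s i) + L * \<epsilon>"
    by (simp add: divide_right_mono)
  with s(1) have le: "(\<integral>y. g y \<partial>Q) \<le> \<tau> * \<beta>" by simp
  have "integrable Q g"
    using integrable_lipschitz_lr[OF g lipg] Q \<open>0 < L\<close> by (auto simp: ambiguity_set_def)
  then have "(\<integral>\<^sup>+y. ennreal (g y) \<partial>Q) = ennreal (\<integral>y. g y \<partial>Q)"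
    by (rule nn_integral_eq_integral) (simp add: g_def)
  moreover have "0 \<le> (\<integral>y. g y \<partial>Q)" by (rule Bochner_Integration.integral_nonneg) (simp add: g_def)
  ultimately have "ereal (1 / \<beta>) * enn2ereal (\<integral>\<^sup>+y. ennreal (g y) \<partial>Q) + ereal (- \<tau>)
      = ereal (1 / \<beta> * (\<integral>y. g y \<partial>Q) - \<tau>)"
    by (simp add: enn2ereal_ennreal)
  also have "\<dots> \<le> 0" using le \<open>0 < \<beta>\<close> by (simp add: field_simps)
  finally show ?thesis unfolding cvar_def g_def by (intro INF_lower2[of "- \<tau>"]) auto
qed

section \<open>Comparison of the two optimization problems\<close>

theorem theorem1:
  fixes T :: nat
    and ud :: "nat \<Rightarrow> real ^ 'm::finite" and yd :: "nat \<Rightarrow> real ^ 'p::finite"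
    and Hu :: "real ^ 'n::{finite,linorder} ^ (('tp::{finite,linorder} + 'tf::{finite,linorder}) \<times> 'm)"
    and Hy :: "real ^ 'n::_ ^ (('tp + 'tf) \<times> 'p)"
    and Up :: "real ^ 'n::_ ^ ('tp \<times> 'm)" and Uf :: "real ^ 'n::_ ^ ('tf \<times> 'm)"
    and Yp :: "real ^ 'n::_ ^ ('tp \<times> 'p)" and Yf :: "real ^ 'n::_ ^ ('tf \<times> 'p)"
    and M :: "real ^ 'n::_ ^ ('tp \<times> 'm + 'tp \<times> 'p + 'tf \<times> 'm)"
    and K :: "real ^ ('tp \<times> 'm + 'tp \<times> 'p + 'tf \<times> 'm) ^ ('tf \<times> 'p)"
    and \<xi> :: "'n \<Rightarrow> real ^ ('tf \<times> 'p)"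
    and up :: "real ^ ('tp \<times> 'm)" and yp :: "real ^ ('tp \<times> 'p)"
    and mf :: "real ^ ('tf \<times> 'm) \<Rightarrow> real ^ ('tp \<times> 'm + 'tp \<times> 'p + 'tf \<times> 'm)"
    and a :: "real ^ ('tf \<times> 'm) \<Rightarrow> 'n \<Rightarrow> real ^ ('tf \<times> 'p)"
    and Ptrue :: "real ^ ('tp \<times> 'm + 'tp \<times> 'p + 'tf \<times> 'm) \<Rightarrow> (real ^ ('tf \<times> 'p)) measure"
    and B :: "real ^ ('tf \<times> 'm) \<Rightarrow> (real ^ ('tf \<times> 'p)) measure set"
    and f1 :: "real ^ ('tf \<times> 'm) \<Rightarrow> real" and f2 h :: "real ^ ('tf \<times> 'p) \<Rightarrow> real"
    and U :: "(real ^ ('tf \<times> 'm)) set"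
    and \<beta> \<epsilon> Lobj Lcon :: real and r :: ereal
  assumes "CARD('tp) + CARD('tf) \<le> T"
    and "CARD('n) = T - (CARD('tp) + CARD('tf)) + 1"
    and "Hu = hankel ud" and "Hy = hankel yd"
    and "Up = past_rows Hu" and "Uf = future_rows Hu"
    and "Yp = past_rows Hy" and "Yf = future_rows Hy"
    and "M = stack3 Up Yp Uf"
    and "K = Yf ** pinv M"
    and "\<And>i. \<xi> i = (Yf - K ** M) *v axis i 1"
    and "\<And>uf. mf uf = stack3 up yp uf"
    and "\<And>uf i. a uf i = K *v mf uf + \<xi> i"
    and "\<And>x. prob_space (Ptrue x)" and "\<And>x. sets (Ptrue x) = sets borel"
    and "\<And>uf. B uf = ambiguity_set r (measure_support (Ptrue (mf uf))) \<epsilon> (empirical (a uf))"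
    and "0 < \<beta>" and "\<beta> < 1" and "\<epsilon> > 0" and "1 \<le> r"
    and "convex_on UNIV f2" and "Lobj > 0" and "lipschitz_lr r Lobj f2"
    and "convex_on UNIV h" and "Lcon > 0" and "lipschitz_lr r Lcon h"
  shows "dro_value f1 f2 h U \<beta> B \<le> reform_value f1 f2 h U \<beta> Lobj Lcon \<epsilon> a \<and>
    (\<forall>uf. (\<exists>\<tau> s. reform_feasible h U \<beta> Lcon \<epsilon> a uf \<tau> s) \<longrightarrow>
       (\<forall>Q\<in>B uf. cvar Q \<beta> h \<le> 0))"
proof -
  have f2: "f2 \<in> borel_measurable borel" and h: "h \<in> borel_measurable borel"
    by (rule borel_measurable_convex, fact)+
  \<comment> \<open>Used twice: as the second claim, and to show that \<open>uf\<close> is feasible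
    for the robust problem.\<close>
  have cvar: "cvar Q \<beta> h \<le> 0" if "reform_feasible h U \<beta> Lcon \<epsilon> a uf \<tau> s" "Q \<in> B uf" for uf \<tau> s Q
  proof (rule cvar_le_0[OF h \<open>lipschitz_lr r Lcon h\<close> \<open>Lcon > 0\<close>])
    show "Q \<in> ambiguity_set r (measure_support (Ptrue (mf uf))) \<epsilon> (empirical (a uf))"
      using that(2) unfolding assms(16) .
  qed (use that(1) \<open>\<epsilon> > 0\<close> \<open>1 \<le> r\<close> \<open>0 < \<beta>\<close> in \<open>auto simp: reform_feasible_def\<close>)
  have "dro_value f1 f2 h U \<beta> B \<le> ereal (f1 uf + 1 / real CARD('n) * (\<Sum>i\<in>UNIV. f2 (a uf i)) + Lobj * \<epsilon>)"
    if *: "reform_feasible h U \<beta> Lcon \<epsilon> a uf \<tau> s" for uf \<tau> s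
  proof -
    \<comment> \<open>Bounding every \<open>Q\<close> separately also covers an empty ambiguity set,
      where the supremum is -\<infinity>.\<close>
    have "(SUP Q\<in>B uf. ereal (\<integral>y. f2 y \<partial>Q)) \<le> ereal (1 / real CARD('n) * (\<Sum>i\<in>UNIV. f2 (a uf i)) + Lobj * \<epsilon>)"
    proof (rule SUP_least)
      fix Q assume "Q \<in> B uf"
      then have Q: "Q \<in> ambiguity_set r (measure_support (Ptrue (mf uf))) \<epsilon> (empirical (a uf))"
        using assms(16) by simp
      show "ereal (\<integral>y. f2 y \<partial>Q) \<le> ereal (1 / real CARD('n) * (\<Sum>i\<in>UNIV. f2 (a uf i)) + Lobj * \<epsilon>)"
        using integral_ambiguity_set_le[OF f2 \<open>lipschitz_lr r Lobj f2\<close> \<open>Lobj > 0\<close> Q integrable_empirical[OF f2]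
          \<open>\<epsilon> > 0\<close> \<open>1 \<le> r\<close>]
        by (simp add: integral_empirical[OF f2])
    qed
    then have "ereal (f1 uf) + (SUP Q\<in>B uf. ereal (\<integral>y. f2 y \<partial>Q))
        \<le> ereal (f1 uf) + ereal (1 / real CARD('n) * (\<Sum>i\<in>UNIV. f2 (a uf i)) + Lobj * \<epsilon>)"
      by (rule add_left_mono)
    moreover have "uf \<in> {uf \<in> U. (SUP Q\<in>B uf. cvar Q \<beta> h) \<le> 0}"
      using * cvar[OF *] by (auto simp: reform_feasible_def intro: SUP_least)
    ultimately show ?thesis
      unfolding dro_value_def by (intro INF_lower2) (auto simp: add.assoc)
  qed
  \<comment> \<open>If the second problem is infeasible, its value is \<infinity> and
    \<open>INF_greatest\<close> holds vacuously.\<close>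
  then have "dro_value f1 f2 h U \<beta> B \<le> reform_value f1 f2 h U \<beta> Lobj Lcon \<epsilon> a"
    unfolding reform_value_def by (intro INF_greatest) auto
  with cvar show ?thesis by blast
qed

end
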